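(* Let $S$ be a semigroup with $|S|\ge 2$ and with no identity element. Then $S^1$ is uniform if and only if $S$ is uniform and has no left identity element.
   Context: A right $S$-act is a nonempty set $A$ with a map $A\times S\to A$, $(a,s)\mapsto as$, with $a(st)=(as)t$. A subact is a nonempty subset closed under the action; an $S$-homomorphism is a map $f$ with $f(as)=f(a)s$; a monomorphism is an injective $S$-homomorphism. A subact is nonzero if it is not a one-element subact. A subact $B$ of $A$ is large in $A$ if every $S$-homomorphism $g:A\to C$ (for any right $S$-act $C$) whose restriction to $B$ is injective is itself injective. A right $S$-act is uniform if every nonzero subact is large in it. A semigroup $S$ is uniform (i.e. right uniform) if the right $S$-act $S_S$ ($S$ acting on itself by right multiplication; its subacts are the nonempty right ideals) is uniform. Since $S$ has no identity, $S^1=S\cup\{1\}$ with a new identity element $1$ adjoined. A left identity is $e\in S$ with $es=s$ for all $s\in S$. *)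

theory Defs
  imports Main
begin

text \<open>
  A semigroup is given by an operation \<open>m\<close> on a whole type, subject to the library locale
  predicate \<open>semigroup m\<close>. Acts have explicit carrier sets; their actions are only
  constrained on the carrier. No unit law is imposed on acts, even if \<open>m\<close> has an identity.
\<close>

definition right_act :: "('s \<Rightarrow> 's \<Rightarrow> 's) \<Rightarrow> 'a set \<Rightarrow> ('a \<Rightarrow> 's \<Rightarrow> 'a) \<Rightarrow> bool" where
  "right_act m A act \<longleftrightarrow>
     A \<noteq> {} \<and> (\<forall>a\<in>A. \<forall>s. act a s \<in> A) \<and> (\<forall>a\<in>A. \<forall>s t. act a (m s t) = act (act a s) t)"

definition subact :: "'a set \<Rightarrow> 'a set \<Rightarrow> ('a \<Rightarrow> 's \<Rightarrow> 'a) \<Rightarrow> bool" where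
  "subact B A act \<longleftrightarrow> B \<noteq> {} \<and> B \<subseteq> A \<and> (\<forall>b\<in>B. \<forall>s. act b s \<in> B)"

definition act_hom ::
  "'a set \<Rightarrow> ('a \<Rightarrow> 's \<Rightarrow> 'a) \<Rightarrow> 'c set \<Rightarrow> ('c \<Rightarrow> 's \<Rightarrow> 'c) \<Rightarrow> ('a \<Rightarrow> 'c) \<Rightarrow> bool" where
  "act_hom A act C act' g \<longleftrightarrow> g ` A \<subseteq> C \<and> (\<forall>a\<in>A. \<forall>s. g (act a s) = act' (g a) s)"

definition nonzero_subact :: "'a set \<Rightarrow> 'a set \<Rightarrow> ('a \<Rightarrow> 's \<Rightarrow> 'a) \<Rightarrow> bool" where
  "nonzero_subact B A act \<longleftrightarrow> subact B A act \<and> \<not> is_singleton B"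

text \<open>
  HOL cannot quantify over the type of the codomain \<open>C\<close> inside a definition. Letting \<open>C\<close> range
  over all acts carried by subsets of the element type of \<open>A\<close> loses nothing; the lemma
  \<open>large_any_codomain\<close> below gives the property for codomains over an arbitrary type.
\<close>

definition large ::
  "('s \<Rightarrow> 's \<Rightarrow> 's) \<Rightarrow> 'a set \<Rightarrow> 'a set \<Rightarrow> ('a \<Rightarrow> 's \<Rightarrow> 'a) \<Rightarrow> bool" where
  "large m B A act \<longleftrightarrow> subact B A act \<and>
     (\<forall>(C :: 'a set) act' g.
        right_act m C act' \<longrightarrow> act_hom A act C act' g \<longrightarrow> inj_on g B \<longrightarrow> inj_on g A)"

lemma large_any_codomain:
  fixes C :: "'c set"
  assumes A: "right_act m A act" and large: "large m B A act"
    and C: "right_act m C act'" and hom: "act_hom A act C act' g" and inj: "inj_on g B"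
  shows "inj_on g A"
proof -
  define r where "r = inv_into A g"
  define h where "h = r \<circ> g"
  define D where "D = h ` A"
  define act2 where "act2 = (\<lambda>c s. h (act c s))"
  have hA: "h a \<in> A" and gh: "g (h a) = g a" if "a \<in> A" for a
    using that by (auto simp: h_def r_def inv_into_into f_inv_into_f)
  have clo: "act a s \<in> A" if "a \<in> A" for a s
    using A that by (auto simp: right_act_def)
  have assoc: "act a (m s t) = act (act a s) t" if "a \<in> A" for a s t
    using A that by (auto simp: right_act_def)
  have gact: "g (act a s) = act' (g a) s" if "a \<in> A" for a s
    using hom that by (auto simp: act_hom_def)
  have hact: "h (act (h a) s) = h (act a s)" if "a \<in> A" for a s
    using that hA gh gact by (simp add: h_def)
  have hact2: "h (act (act (h a) s) t) = h (act (act a s) t)" if "a \<in> A" for a s t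
    using hact[OF that, of "m s t"] assoc[OF that] assoc[OF hA[OF that]] by simp
  have "right_act m D act2"
    using A by (auto simp: right_act_def D_def act2_def hact hact2 hA clo assoc)
  moreover have "act_hom A act D act2 h"
    by (auto simp: act_hom_def D_def act2_def hact)
  moreover have BA: "B \<subseteq> A"
    using large by (auto simp: large_def subact_def)
  have "inj_on h B"
  proof (rule inj_onI)
    fix x y assume xy: "x \<in> B" "y \<in> B" "h x = h y"
    then have "g x = g y" using BA gh by (metis subsetD)
    with xy inj show "x = y" by (auto dest: inj_onD)
  qed
  ultimately have "inj_on h A"
    using large by (auto simp: large_def)
  then show ?thesis
    by (auto simp: h_def intro: inj_on_imageI2)
qed

definition uniform_act :: "('s \<Rightarrow> 's \<Rightarrow> 's) \<Rightarrow> 'a set \<Rightarrow> ('a \<Rightarrow> 's \<Rightarrow> 'a) \<Rightarrow> bool" where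
  "uniform_act m A act \<longleftrightarrow> (\<forall>B. nonzero_subact B A act \<longrightarrow> large m B A act)"

definition uniform_semigroup :: "('s \<Rightarrow> 's \<Rightarrow> 's) \<Rightarrow> bool" where
  "uniform_semigroup m \<longleftrightarrow> uniform_act m UNIV m"

text \<open>The operation of \<open>S\<^sup>1\<close>, with \<open>None\<close> as the new identity element.\<close>

fun adjoin_one :: "('s \<Rightarrow> 's \<Rightarrow> 's) \<Rightarrow> 's option \<Rightarrow> 's option \<Rightarrow> 's option" where
  "adjoin_one m None y = y"
| "adjoin_one m (Some a) None = Some a"
| "adjoin_one m (Some a) (Some b) = Some (m a b)"

lemma semigroup_adjoin_one:
  assumes "semigroup m"
  shows "semigroup (adjoin_one m)"
proof
  interpret semigroup m by fact
  show "adjoin_one m (adjoin_one m a b) c = adjoin_one m a (adjoin_one m b c)" for a b c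
    by (cases a; cases b; cases c) (simp_all add: assoc)
qed

end

(*
  Largeness is a statement about right congruences: a subact B of A is large iff the only
  right congruence on A that is trivial on B is the identity. A right congruence on S extends
  to S^1 by making 1 congruent only to itself. Conversely, if a right congruence on S^1 is
  trivial on S and relates 1 to an element a of S, then it relates s to a s for all s in S, so a
  is a left identity. Finally, if e is a left identity of S, left multiplication by e is a
  homomorphism on S^1 that is injective on S and identifies 1 and e.
*)
theory Submission
  imports Defs
begin

definition right_congruence :: "'a set \<Rightarrow> ('a \<Rightarrow> 's \<Rightarrow> 'a) \<Rightarrow> ('a \<times> 'a) set \<Rightarrow> bool" where
  "right_congruence A act R \<longleftrightarrow>
     equiv A R \<and> (\<forall>a b s. (a, b) \<in> R \<longrightarrow> (act a s, act b s) \<in> R)"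

text \<open>Right congruences are exactly the kernels of homomorphisms: each one is the kernel of
  the projection onto its quotient act, and conversely the kernel of any homomorphism is a right
  congruence. This removes the codomain from the arguments below.\<close>

lemma large_iff_congruence:
  fixes A :: "'a set"
  assumes A: "right_act m A act"
  shows "large m B A act \<longleftrightarrow> subact B A act \<and>
    (\<forall>R. right_congruence A act R \<longrightarrow> R \<inter> B \<times> B \<subseteq> Id \<longrightarrow> R \<subseteq> Id)"
proof (intro iffI conjI allI impI)
  assume L: "large m B A act"
  then show sub: "subact B A act" by (simp add: large_def)
  fix R assume R: "right_congruence A act R" and triv: "R \<inter> B \<times> B \<subseteq> Id"
  have comp: "(act a s, act b s) \<in> R" if "(a, b) \<in> R" for a b s
    using R that by (auto simp: right_congruence_def)
  have eqR: "equiv A R" using R by (simp add: right_congruence_def)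
  have clo: "act a s \<in> A" if "a \<in> A" for a s
    using A that by (auto simp: right_act_def)
  have assoc: "act a (m s t) = act (act a s) t" if "a \<in> A" for a s t
    using A that by (auto simp: right_act_def)
  define g where "g a = R `` {a}" for a
  define act' where "act' c s = g (act (SOME x. x \<in> c) s)" for c s
  have act'_g: "act' (g a) s = g (act a s)" if "a \<in> A" for a s
  proof -
    have "a \<in> g a"
      using equiv_class_self[OF eqR that] by (simp add: g_def)
    then have "(SOME x. x \<in> g a) \<in> g a" by (rule someI)
    then have "(a, SOME x. x \<in> g a) \<in> R" by (simp add: g_def)
    then have "(act a s, act (SOME x. x \<in> g a) s) \<in> R" by (rule comp)
    then show ?thesis
      using equiv_class_eq[OF eqR] by (simp add: act'_def g_def)
  qed
  have "right_act m (g ` A) act'"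
    using A by (auto simp: right_act_def act'_g clo assoc)
  moreover have "act_hom A act (g ` A) act' g"
    by (auto simp: act_hom_def act'_g)
  moreover have "inj_on g B"
  proof (rule inj_onI)
    fix x y assume xy: "x \<in> B" "y \<in> B" "g x = g y"
    then have "(x, y) \<in> R"
      using sub eq_equiv_class[OF _ eqR] by (auto simp: g_def subact_def)
    with xy triv show "x = y" by auto
  qed
  \<comment> \<open>The quotient consists of sets over \<open>'a\<close>, so it is not among the
    codomains in the definition of \<open>large\<close>; the version for arbitrary codomain types is
    required.\<close>
  ultimately have inj: "inj_on g A"
    by (rule large_any_codomain[OF A L])
  show "R \<subseteq> Id"
  proof clarify
    fix x y assume xy: "(x, y) \<in> R"
    then have "x \<in> A" "y \<in> A" "g x = g y"
      using eqR equiv_class_eq[OF eqR xy] by (auto simp: g_def equiv_def refl_on_def)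
    with inj show "x = y" by (auto dest: inj_onD)
  qed
next
  assume *: "subact B A act \<and>
    (\<forall>R. right_congruence A act R \<longrightarrow> R \<inter> B \<times> B \<subseteq> Id \<longrightarrow> R \<subseteq> Id)"
  have "inj_on g A" if hom: "act_hom A act C act' g" and inj: "inj_on g B"
    for C :: "'a set" and act' g
  proof -
    \<comment> \<open>The kernel of \<open>g\<close> on \<open>A\<close>: it is trivial on a subset
      exactly when \<open>g\<close> is injective there.\<close>
    define R where "R = {(a, b). a \<in> A \<and> b \<in> A \<and> g a = g b}"
    have "right_congruence A act R"
      using A hom
      by (auto simp: right_congruence_def R_def equiv_def refl_on_def sym_def trans_def
          right_act_def act_hom_def)
    moreover have "R \<inter> B \<times> B \<subseteq> Id"
      using inj by (auto simp: R_def dest: inj_onD)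
    ultimately have "R \<subseteq> Id" using * by blast
    then show ?thesis by (auto simp: R_def inj_on_def)
  qed
  with * show "large m B A act" unfolding large_def by blast
qed

lemma right_act_self: "semigroup m \<Longrightarrow> right_act m UNIV m"
  by (auto simp: right_act_def semigroup.assoc)

lemma uniform_semigroup_iff_congruence:
  assumes "semigroup m"
  shows "uniform_semigroup m \<longleftrightarrow>
    (\<forall>B R. nonzero_subact B UNIV m \<longrightarrow> right_congruence UNIV m R \<longrightarrow>
       R \<inter> B \<times> B \<subseteq> Id \<longrightarrow> R \<subseteq> Id)"
  unfolding uniform_semigroup_def uniform_act_def
    large_iff_congruence[OF right_act_self[OF assms]]
  by (auto simp: nonzero_subact_def)

lemma adjoin_one_None_right [simp]: "adjoin_one m x None = x"
  by (cases x) simp_all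

text \<open>A right ideal of S stays a right ideal of S^1, because multiplying by the new element
  \<open>None\<close> on the right changes nothing.\<close>

lemma nonzero_subact_adjoin_one:
  assumes "nonzero_subact B UNIV m"
  shows "nonzero_subact (Some ` B) UNIV (adjoin_one m)"
proof -
  have "adjoin_one m (Some b) s \<in> Some ` B" if "b \<in> B" for b s
    using assms that by (cases s) (auto simp: nonzero_subact_def subact_def)
  \<comment> \<open>Since \<open>Some\<close> is injective, the image has the same cardinality as
    \<open>B\<close>, so it is not a singleton either.\<close>
  then show ?thesis
    using assms
    by (auto simp: nonzero_subact_def subact_def is_singleton_altdef card_image)
qed

lemma right_congruence_adjoin_one:
  assumes "right_congruence UNIV m R"
  shows "right_congruence UNIV (adjoin_one m) (insert (None, None) (map_prod Some Some ` R))"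
    (is "right_congruence _ _ ?T")
proof -
  have *: "(x, y) \<in> ?T \<longleftrightarrow>
      x = None \<and> y = None \<or> (\<exists>a b. x = Some a \<and> y = Some b \<and> (a, b) \<in> R)" for x y
    by auto
  have R: "refl R" "sym R" "trans R"
    and comp: "\<And>a b s. (a, b) \<in> R \<Longrightarrow> (m a s, m b s) \<in> R"
    using assms by (auto simp: right_congruence_def equiv_def)
  have "(x, x) \<in> ?T" for x
    using R(1) unfolding * by (cases x) (auto simp: refl_on_def)
  moreover have "(y, x) \<in> ?T" if "(x, y) \<in> ?T" for x y
    using that R(2) unfolding * by (auto dest: symD)
  moreover have "(x, z) \<in> ?T" if "(x, y) \<in> ?T" "(y, z) \<in> ?T" for x y z
    using that R(3) unfolding * by (auto dest: transD)
  ultimately have "equiv UNIV ?T"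
    unfolding equiv_def refl_on_def sym_def trans_def by blast
  \<comment> \<open>The pair \<open>(None, None)\<close> is carried to \<open>(s, s)\<close>, which
    is covered by reflexivity of \<open>?T\<close>; pairs coming from \<open>R\<close> remain there,
    also for \<open>s = None\<close>.\<close>
  moreover have "(adjoin_one m x s, adjoin_one m y s) \<in> ?T" if "(x, y) \<in> ?T" for x y s
    using that \<open>\<And>x. (x, x) \<in> ?T\<close> comp unfolding * by (cases s) auto
  ultimately show ?thesis by (simp add: right_congruence_def)
qed

lemma uniform_semigroup_if_adjoin_one:
  assumes m: "semigroup m" and U: "uniform_semigroup (adjoin_one m)"
  shows "uniform_semigroup m"
  unfolding uniform_semigroup_iff_congruence[OF m]
proof (intro allI impI)
  fix B R
  assume B: "nonzero_subact B UNIV m" and R: "right_congruence UNIV m R"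
    and triv: "R \<inter> B \<times> B \<subseteq> Id"
  have "insert (None, None) (map_prod Some Some ` R) \<inter> Some ` B \<times> Some ` B \<subseteq> Id"
    using triv by auto
  then have "insert (None, None) (map_prod Some Some ` R) \<subseteq> Id"
    using U[unfolded uniform_semigroup_iff_congruence[OF semigroup_adjoin_one[OF m]]]
      nonzero_subact_adjoin_one[OF B] right_congruence_adjoin_one[OF R] by blast
  then show "R \<subseteq> Id" by auto
qed

lemma no_left_identity_if_adjoin_one_uniform:
  assumes m: "semigroup m" and ne: "(x :: 's) \<noteq> y" and U: "uniform_semigroup (adjoin_one m)"
  shows "\<nexists>e :: 's. \<forall>s. m e s = s"
proof
  assume "\<exists>e. \<forall>s. m e s = s"
  then obtain e where e: "\<And>s. m e s = s" by blast
  \<comment> \<open>Two distinct elements ensure that S is a nonzero subact, so its copy in S^1 must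
    be large.\<close>
  have "nonzero_subact UNIV UNIV m"
    using ne by (auto simp: nonzero_subact_def subact_def is_singleton_def)
      (metis UNIV_I singletonD)
  then have "nonzero_subact (range Some) UNIV (adjoin_one m)"
    by (rule nonzero_subact_adjoin_one)
  then have "large (adjoin_one m) (range Some) UNIV (adjoin_one m)"
    using U by (simp add: uniform_semigroup_def uniform_act_def)
  moreover have "act_hom UNIV (adjoin_one m) UNIV (adjoin_one m) (adjoin_one m (Some e))"
    using semigroup.assoc[OF semigroup_adjoin_one[OF m]] by (simp add: act_hom_def)
  moreover have "inj_on (adjoin_one m (Some e)) (range Some)"
    by (auto simp: inj_on_def e)
  ultimately have "inj (adjoin_one m (Some e))"
    using right_act_self[OF semigroup_adjoin_one[OF m]] by (auto simp: large_def)
  \<comment> \<open>Both sides are \<open>Some e\<close>: e times 1 is e, and e times e is e because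
    e is a left identity.\<close>
  moreover have "adjoin_one m (Some e) None = adjoin_one m (Some e) (Some e)"
    by (simp add: e)
  ultimately show False by (blast dest: injD)
qed

text \<open>A right ideal of S^1 either contains 1, and is then all of S^1, or is a right ideal of
  S. In the second case uniformity of S makes the congruence trivial on S, and only pairs involving
  1 remain.\<close>

lemma adjoin_one_uniform:
  assumes m: "semigroup m" and U: "uniform_semigroup m"
    and noid: "\<nexists>e. \<forall>s. m e s = s"
  shows "uniform_semigroup (adjoin_one m)"
  unfolding uniform_semigroup_iff_congruence[OF semigroup_adjoin_one[OF m]]
proof (intro allI impI)
  fix B R
  assume B: "nonzero_subact B UNIV (adjoin_one m)"
    and R: "right_congruence UNIV (adjoin_one m) R" and triv: "R \<inter> B \<times> B \<subseteq> Id"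
  have clo: "adjoin_one m b s \<in> B" if "b \<in> B" for b s
    using B that by (auto simp: nonzero_subact_def subact_def)
  have refl: "refl R" and sym: "sym R" and trans: "trans R"
    and comp: "(x, y) \<in> R \<Longrightarrow> (adjoin_one m x s, adjoin_one m y s) \<in> R" for x y s
    using R by (auto simp: right_congruence_def equiv_def)
  show "R \<subseteq> Id"
  proof (cases "None \<in> B")
    case True
    \<comment> \<open>Every element x is the product of 1 and x, so it lies in
      \<open>B\<close>.\<close>
    then have "B = UNIV" using clo[OF True] by auto
    with triv show ?thesis by auto
  next
    case False
    define B' where "B' = {b. Some b \<in> B}"
    define R' where "R' = {(a, b). (Some a, Some b) \<in> R}"
    have BB: "B = Some ` B'"
    proof
      show "B \<subseteq> Some ` B'"
      proof
        fix x assume "x \<in> B"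
        with False show "x \<in> Some ` B'" by (cases x) (auto simp: B'_def)
      qed
    qed (auto simp: B'_def)
    have "m b s \<in> B'" if "b \<in> B'" for b s
      using clo[of "Some b" "Some s"] that by (simp add: B'_def)
    then have "nonzero_subact B' UNIV m"
      using B by (auto simp: BB nonzero_subact_def subact_def is_singleton_altdef card_image)
    moreover have "right_congruence UNIV m R'"
    proof -
      have "refl R'" "sym R'" "trans R'"
        using refl sym trans unfolding R'_def refl_on_def sym_def trans_def by blast+
      moreover have "(m a s, m b s) \<in> R'" if "(a, b) \<in> R'" for a b s
        using comp[of "Some a" "Some b" "Some s"] that by (simp add: R'_def)
      ultimately show ?thesis by (simp add: right_congruence_def equiv_def)
    qed
    moreover have "R' \<inter> B' \<times> B' \<subseteq> Id"
      using triv by (auto simp: R'_def B'_def)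
    ultimately have "R' \<subseteq> Id"
      using U[unfolded uniform_semigroup_iff_congruence[OF m]] by blast
    then have Some_eq: "a = b" if "(Some a, Some b) \<in> R" for a b
      using that by (auto simp: R'_def)
    \<comment> \<open>Multiplying the pair by \<open>Some s\<close> moves both components into S,
      where related elements are equal; hence a would be a left identity.\<close>
    have None: False if "(None, Some a) \<in> R" for a
    proof -
      have "m a s = s" for s
        using comp[OF that, of "Some s"] Some_eq[of s "m a s"] by simp
      with noid show False by blast
    qed
    have "x = y" if "(x, y) \<in> R" for x y
      \<comment> \<open>Symmetry reduces a pair \<open>(Some a, None)\<close> to the case excluded
        by \<open>None\<close>.\<close>
      using that symD[OF sym that] Some_eq None by (cases x; cases y) auto
    then show ?thesis by auto
  qed
qed

theorem theorem2p7:
  fixes m :: "'s \<Rightarrow> 's \<Rightarrow> 's"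
  assumes "semigroup m"
    and "\<exists>x y :: 's. x \<noteq> y"
    and "\<nexists>e. \<forall>s. m e s = s \<and> m s e = s"
  shows "uniform_semigroup (adjoin_one m) \<longleftrightarrow>
    uniform_semigroup m \<and> (\<nexists>e. \<forall>s. m e s = s)"
proof -
  obtain x y :: 's where "x \<noteq> y" using assms(2) by blast
  then show ?thesis
    using uniform_semigroup_if_adjoin_one[OF assms(1)]
      no_left_identity_if_adjoin_one_uniform[OF assms(1)] adjoin_one_uniform[OF assms(1)]
    by blast
qed

end
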